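(* Let $(\mathfrak{g}, [\cdot,\cdot]_{\mathfrak{g}}, \alpha_{\mathfrak{g}}, \langle\cdot,\cdot\rangle)$ be an involutive Lorentzian Hom-Lie algebra. (i) If $\mathfrak{g}$ has negative Ricci curvature on timelike vectors, i.e. $\mathrm{Ric}(x,x)<0$ for every timelike $x\in\mathfrak{g}$, then $\mathfrak{g}$ admits no non-trivial timelike Killing vector. (ii) If $\mathfrak{g}$ has non-positive Ricci curvature on timelike vectors, i.e. $\mathrm{Ric}(x,x)\le 0$ for every timelike $x\in\mathfrak{g}$, then every timelike Killing vector $v\in\mathfrak{g}$ is parallel, i.e. $\nabla_x v=0$ for all $x\in\mathfrak{g}$.
   Context: A Hom-Lie algebra is a triple $(\mathfrak{g},[\cdot,\cdot]_{\mathfrak{g}},\alpha_{\mathfrak{g}})$ where $\mathfrak{g}$ is a (here finite-dimensional real) vector space, $[\cdot,\cdot]_{\mathfrak{g}}:\mathfrak{g}\times\mathfrak{g}\to\mathfrak{g}$ is a skew-symmetric bilinear map, and $\alpha_{\mathfrak{g}}:\mathfrak{g}\to\mathfrak{g}$ is a linear map with $\alpha_{\mathfrak{g}}([x,y]_{\mathfrak{g}})=[\alpha_{\mathfrak{g}}(x),\alpha_{\mathfrak{g}}(y)]_{\mathfrak{g}}$ for all $x,y$, such that the Hom-Jacobi identity $[\alpha_{\mathfrak{g}}(x),[y,z]_{\mathfrak{g}}]_{\mathfrak{g}}+[\alpha_{\mathfrak{g}}(y),[z,x]_{\mathfrak{g}}]_{\mathfrak{g}}+[\alpha_{\mathfrak{g}}(z),[x,y]_{\mathfrak{g}}]_{\mathfrak{g}}=0$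 holds for all $x,y,z\in\mathfrak{g}$. It is involutive if $\alpha_{\mathfrak{g}}^2=\mathrm{Id}_{\mathfrak{g}}$ (in particular $\alpha_{\mathfrak{g}}$ is invertible). A pseudo-Riemannian Hom-Lie algebra is such a triple together with a non-degenerate symmetric bilinear form $\langle\cdot,\cdot\rangle:\mathfrak{g}\times\mathfrak{g}\to\mathbb{R}$ with $\langle\alpha_{\mathfrak{g}}(x),\alpha_{\mathfrak{g}}(y)\rangle=\langle x,y\rangle$ for all $x,y$. It is called Lorentzian if $\langle\cdot,\cdot\rangle$ has signature $(1,n-1)$, $n=\dim\mathfrak{g}$, meaning one negative and $n-1$ positive directions. A vector $v$ is timelike if $\langle v,v\rangle<0$. The Hom-Levi-Civita connection is the unique bilinear map $\nabla:\mathfrak{g}\times\mathfrak{g}\to\mathfrak{g}$, $(x,y)\mapsto\nabla_x y$, given by the Koszul formula $$2\langle\nabla_x y,\alpha_{\mathfrak{g}}(z)\rangle=\langle[x,y]_{\mathfrak{g}},\alpha_{\mathfrak{g}}(z)\rangle+\langle[z,y]_{\mathfrak{g}},\alpha_{\mathfrak{g}}(x)\rangle+\langle[z,x]_{\mathfrak{g}},\alpha_{\mathfrak{g}}(y)\rangle$$ for all $x,y,z\in\mathfrak{g}$. It satisfies $[x,y]_{\mathfrak{g}}=\nabla_x y-\nabla_y x$, $\langle\nabla_x y,\alpha_{\mathfrak{g}}(z)\rangle=-\langle\alpha_{\mathfrak{g}}(y),\nabla_x z\rangle$ and $\alpha_{\mathfrak{g}}(\nabla_x y)=\nabla_{\alpha_{\mathfrak{g}}(x)}\alpha_{\mathfrak{g}}(y)$.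 The curvature tensor is $R(x,y)z=\nabla_{\alpha_{\mathfrak{g}}(x)}\nabla_y z-\nabla_{\alpha_{\mathfrak{g}}(y)}\nabla_x z-\nabla_{[x,y]_{\mathfrak{g}}}\alpha_{\mathfrak{g}}(z)$, and the Ricci curvature is $\mathrm{Ric}(x,y)=\mathrm{tr}\big(z\mapsto R(z,x)y\big)$. A vector $v\in\mathfrak{g}$ is Killing if $\langle\nabla_x v,\alpha_{\mathfrak{g}}(y)\rangle=-\langle\nabla_y v,\alpha_{\mathfrak{g}}(x)\rangle$ for all $x,y\in\mathfrak{g}$. *)

theory Defs
  imports "HOL-Analysis.Analysis"
begin

locale hom_lie_algebra =
  fixes br :: "'a::real_vector \<Rightarrow> 'a \<Rightarrow> 'a"
    and \<alpha> :: "'a \<Rightarrow> 'a"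
  assumes finite_dimensional: "\<exists>B::'a set. finite B \<and> span B = UNIV"
    and bilinear_bracket: "bilinear br"
    and bracket_skew: "br x y = - br y x"
    and linear_twist: "linear \<alpha>"
    and twist_bracket: "\<alpha> (br x y) = br (\<alpha> x) (\<alpha> y)"
    and hom_jacobi: "br (\<alpha> x) (br y z) + br (\<alpha> y) (br z x) + br (\<alpha> z) (br x y) = 0"

locale pseudo_riemannian_hom_lie_algebra = hom_lie_algebra br \<alpha>
  for br :: "'a::real_vector \<Rightarrow> 'a \<Rightarrow> 'a" and \<alpha> :: "'a \<Rightarrow> 'a" +
  fixes g :: "'a \<Rightarrow> 'a \<Rightarrow> real"
  assumes bilinear_metric: "bilinear g"
    and metric_sym: "g x y = g y x"
    and metric_nondegenerate: "(\<And>y. g x y = 0) \<Longrightarrow> x = 0"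
    and twist_isometry: "g (\<alpha> x) (\<alpha> y) = g x y"

text \<open>The signature is written (number of negative directions, number of positive directions)
  and is read off an orthogonal basis; by Sylvester's law it does not depend on that basis.\<close>

definition has_signature :: "('a::real_vector \<Rightarrow> 'a \<Rightarrow> real) \<Rightarrow> nat \<Rightarrow> nat \<Rightarrow> bool" where
  "has_signature g p q \<longleftrightarrow>
    (\<exists>B. finite B \<and> independent B \<and> span B = UNIV \<and>
         (\<forall>b\<in>B. \<forall>c\<in>B. b \<noteq> c \<longrightarrow> g b c = 0) \<and>
         card {b\<in>B. g b b < 0} = p \<and> card {b\<in>B. g b b > 0} = q)"

locale involutive_lorentzian_hom_lie_algebra = pseudo_riemannian_hom_lie_algebra br \<alpha> g
  for br :: "'a::real_vector \<Rightarrow> 'a \<Rightarrow> 'a" and \<alpha> :: "'a \<Rightarrow> 'a" and g :: "'a \<Rightarrow> 'a \<Rightarrow> real" +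
  assumes involutive: "\<alpha> (\<alpha> x) = x"
    and lorentzian: "has_signature g 1 (dim (UNIV :: 'a set) - 1)"

definition timelike :: "('a::real_vector \<Rightarrow> 'a \<Rightarrow> real) \<Rightarrow> 'a \<Rightarrow> bool" where
  "timelike g v \<longleftrightarrow> g v v < 0"

text \<open>The Koszul formula has a unique solution when \<open>\<alpha>\<close> is invertible, in particular in
  the involutive case; see \<open>hom_levi_civita_ex1\<close> below.\<close>

definition hom_levi_civita ::
  "('a::real_vector \<Rightarrow> 'a \<Rightarrow> 'a) \<Rightarrow> ('a \<Rightarrow> 'a) \<Rightarrow> ('a \<Rightarrow> 'a \<Rightarrow> real) \<Rightarrow> 'a \<Rightarrow> 'a \<Rightarrow> 'a" where
  "hom_levi_civita br \<alpha> g =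
    (THE nabla. bilinear nabla \<and>
      (\<forall>x y z. 2 * g (nabla x y) (\<alpha> z) =
        g (br x y) (\<alpha> z) + g (br z y) (\<alpha> x) + g (br z x) (\<alpha> y)))"

definition hom_curvature ::
  "('a::real_vector \<Rightarrow> 'a \<Rightarrow> 'a) \<Rightarrow> ('a \<Rightarrow> 'a) \<Rightarrow> ('a \<Rightarrow> 'a \<Rightarrow> real) \<Rightarrow> 'a \<Rightarrow> 'a \<Rightarrow> 'a \<Rightarrow> 'a" where
  "hom_curvature br \<alpha> g x y z =
    (let nabla = hom_levi_civita br \<alpha> g in
      nabla (\<alpha> x) (nabla y z) - nabla (\<alpha> y) (nabla x z) - nabla (br x y) (\<alpha> z))"

text \<open>The trace is computed in a chosen basis; \<open>linear_trace_eq\<close> shows that the choice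
  is irrelevant in finite dimension.\<close>

definition linear_trace :: "('a::real_vector \<Rightarrow> 'a) \<Rightarrow> real" where
  "linear_trace f =
    (let B = (SOME B. independent B \<and> span B = UNIV) in \<Sum>b\<in>B. representation B (f b) b)"

definition hom_ricci ::
  "('a::real_vector \<Rightarrow> 'a \<Rightarrow> 'a) \<Rightarrow> ('a \<Rightarrow> 'a) \<Rightarrow> ('a \<Rightarrow> 'a \<Rightarrow> real) \<Rightarrow> 'a \<Rightarrow> 'a \<Rightarrow> real" where
  "hom_ricci br \<alpha> g x y = linear_trace (\<lambda>z. hom_curvature br \<alpha> g z x y)"

definition hom_killing ::
  "('a::real_vector \<Rightarrow> 'a \<Rightarrow> 'a) \<Rightarrow> ('a \<Rightarrow> 'a) \<Rightarrow> ('a \<Rightarrow> 'a \<Rightarrow> real) \<Rightarrow> 'a \<Rightarrow> bool" where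
  "hom_killing br \<alpha> g v \<longleftrightarrow>
    (\<forall>x y. g (hom_levi_civita br \<alpha> g x v) (\<alpha> y) = - g (hom_levi_civita br \<alpha> g y v) (\<alpha> x))"

definition hom_parallel ::
  "('a::real_vector \<Rightarrow> 'a \<Rightarrow> 'a) \<Rightarrow> ('a \<Rightarrow> 'a) \<Rightarrow> ('a \<Rightarrow> 'a \<Rightarrow> real) \<Rightarrow> 'a \<Rightarrow> bool" where
  "hom_parallel br \<alpha> g v \<longleftrightarrow> (\<forall>x. hom_levi_civita br \<alpha> g x v = 0)"

lemma trace_basis_independent:
  fixes f :: "'a::real_vector \<Rightarrow> 'a"
  assumes f: "linear f"
    and B: "finite B" "independent B" "span B = UNIV"
    and C: "finite C" "independent C" "span C = UNIV"
  shows "(\<Sum>b\<in>B. representation B (f b) b) = (\<Sum>c\<in>C. representation C (f c) c)"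
proof -
  have expB: "(\<Sum>b\<in>B. representation B v b *\<^sub>R b) = v" for v
    using real_vector.sum_representation_eq[of B v B] B by auto
  have expC: "(\<Sum>c\<in>C. representation C v c *\<^sub>R c) = v" for v
    using real_vector.sum_representation_eq[of C v C] C by auto
  have repB: "representation B (\<Sum>i\<in>I. r i *\<^sub>R h i) b = (\<Sum>i\<in>I. r i * representation B (h i) b)"
    for I r b and h :: "'a \<Rightarrow> 'a"
    using B by (simp add: real_vector.representation_sum real_vector.representation_scale)
  have repC: "representation C (\<Sum>i\<in>I. r i *\<^sub>R h i) b = (\<Sum>i\<in>I. r i * representation C (h i) b)"
    for I r b and h :: "'a \<Rightarrow> 'a"
    using C by (simp add: real_vector.representation_sum real_vector.representation_scale)
  have fexp: "f (\<Sum>i\<in>I. r i *\<^sub>R h i) = (\<Sum>i\<in>I. r i *\<^sub>R f (h i))" for I r and h :: "'a \<Rightarrow> 'a"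
    using f by (simp add: linear_sum linear_scale)
  have "representation B (f b) b =
      (\<Sum>c\<in>C. representation C b c * representation B (f c) b)" for b
  proof -
    have "f b = (\<Sum>c\<in>C. representation C b c *\<^sub>R f c)"
      using arg_cong[OF expC[of b], of f] by (simp add: fexp)
    then show ?thesis
      by (simp add: repB)
  qed
  then have "(\<Sum>b\<in>B. representation B (f b) b) =
      (\<Sum>b\<in>B. \<Sum>c\<in>C. representation C b c * representation B (f c) b)"
    by simp
  also have "\<dots> = (\<Sum>c\<in>C. \<Sum>b\<in>B. representation B (f c) b * representation C b c)"
    by (subst sum.swap) (simp add: mult.commute)
  also have "\<dots> = (\<Sum>c\<in>C. representation C (f c) c)"
  proof (rule sum.cong[OF refl])
    fix c
    have "representation C (f c) c = representation C (\<Sum>b\<in>B. representation B (f c) b *\<^sub>R b) c"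
      by (simp add: expB)
    then show "(\<Sum>b\<in>B. representation B (f c) b * representation C b c) = representation C (f c) c"
      using repC[of "representation B (f c)" "\<lambda>b. b" B c] by simp
  qed
  finally show ?thesis .
qed

lemma linear_trace_eq:
  fixes f :: "'a::real_vector \<Rightarrow> 'a"
  assumes "linear f" "finite B" "independent B" "span B = UNIV"
  shows "linear_trace f = (\<Sum>b\<in>B. representation B (f b) b)"
proof -
  define C where "C = (SOME C::'a set. independent C \<and> span C = UNIV)"
  have C: "independent C \<and> span C = UNIV"
    unfolding C_def by (rule someI[of _ B]) (use assms in auto)
  have "finite C"
    using real_vector.independent_span_bound[of B C] assms C by auto
  then show ?thesis
    unfolding linear_trace_def C_def[symmetric] Let_def
    using trace_basis_independent[of f C B] assms C by auto
qed

context pseudo_riemannian_hom_lie_algebra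
begin

lemma metric_eqI:
  assumes "\<And>z. g v z = g w z"
  shows "v = w"
  using metric_nondegenerate[of "v - w"] assms by (simp add: bilinear_lsub[OF bilinear_metric])

lemma metric_represents:
  assumes \<phi>: "linear (\<phi> :: 'a \<Rightarrow> real)"
  shows "\<exists>w. \<forall>z. g w z = \<phi> z"
proof -
  obtain B0 :: "'a set" where B0: "finite B0" "span B0 = UNIV"
    using finite_dimensional by blast
  obtain B where BB: "B \<subseteq> B0" "independent B" "B0 \<subseteq> span B"
    using real_vector.maximal_independent_subset[of B0] by blast
  then have B: "finite B" "independent B" "span B = UNIV"
    using B0 finite_subset real_vector.span_minimal[of B0 "span B"] real_vector.subspace_span[of B]
    by auto
  interpret fd: finite_dimensional_vector_space "scaleR :: real \<Rightarrow> 'a \<Rightarrow> 'a" B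
    using B by unfold_locales (auto simp: dependent_raw_def[symmetric] span_raw_def[symmetric])
  have lin: "linear (\<lambda>z. g w z)" for w
    using bilinear_metric by (simp add: bilinear_def)
  define F where "F w = (\<Sum>b\<in>B. g w b *\<^sub>R b)" for w
  have coeff: "(\<And>b. b \<in> B \<Longrightarrow> r b = s b)"
    if "(\<Sum>b\<in>B. r b *\<^sub>R b) = (\<Sum>b\<in>B. s b *\<^sub>R b)" for r s :: "'a \<Rightarrow> real"
  proof -
    have "(\<Sum>b\<in>B. (r b - s b) *\<^sub>R b) = 0"
      using that by (simp add: scaleR_left_diff_distrib sum_subtractf)
    then show "r b = s b" if "b \<in> B" for b
      using real_vector.independentD[OF B(2,1) order_refl, of "\<lambda>b. r b - s b" b] that by simp
  qed
  have ext: "g w z = \<psi> z" if "linear \<psi>" "\<And>b. b \<in> B \<Longrightarrow> g w b = \<psi> b" for w z \<psi>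
    using linear_eq_on[OF lin that(1), of z B w] that(2) B(3) by auto
  have linF: "linear F"
    unfolding F_def
    by (rule linearI)
      (simp_all add: bilinear_ladd[OF bilinear_metric] bilinear_lmul[OF bilinear_metric]
        scaleR_add_left sum.distrib scaleR_sum_right)
  have "inj F"
  proof (rule injI)
    fix v w assume "F v = F w"
    then have "g v b = g w b" if "b \<in> B" for b
      using coeff[of "g v" "g w"] that by (simp add: F_def)
    then show "v = w"
      using ext[OF lin] by (intro metric_eqI) blast
  qed
  have "surj F"
    using fd.linear_inj_imp_surj[of F] linF \<open>inj F\<close> by (simp add: linear_def)
  then obtain w where "F w = (\<Sum>b\<in>B. \<phi> b *\<^sub>R b)"
    by (metis surjD)
  then have "g w b = \<phi> b" if "b \<in> B" for b
    using coeff[of "g w" \<phi>] that by (simp add: F_def)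
  then show ?thesis
    using ext[OF \<phi>] by blast
qed

end

lemma (in involutive_lorentzian_hom_lie_algebra) hom_levi_civita_ex1:
  "\<exists>!nabla. bilinear nabla \<and>
    (\<forall>x y z. 2 * g (nabla x y) (\<alpha> z) =
      g (br x y) (\<alpha> z) + g (br z y) (\<alpha> x) + g (br z x) (\<alpha> y))"
proof -
  note simps = bilinear_ladd[OF bilinear_metric] bilinear_lmul[OF bilinear_metric]
    bilinear_radd[OF bilinear_metric] bilinear_rmul[OF bilinear_metric]
    bilinear_ladd[OF bilinear_bracket] bilinear_lmul[OF bilinear_bracket]
    bilinear_radd[OF bilinear_bracket] bilinear_rmul[OF bilinear_bracket]
    linear_add[OF linear_twist] linear_scale[OF linear_twist]
  define K where "K x y z =
    (g (br x y) z + g (br (\<alpha> z) y) (\<alpha> x) + g (br (\<alpha> z) x) (\<alpha> y)) / 2" for x y z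
  have "linear (K x y)" for x y
    unfolding K_def by (rule linearI) (simp_all add: simps algebra_simps add_divide_distrib)
  then have "\<forall>x y. \<exists>w. \<forall>z. g w z = K x y z"
    using metric_represents by blast
  then obtain N where N: "\<And>x y z. g (N x y) z = K x y z"
    by metis
  have koszul: "2 * g (M x y) (\<alpha> z) =
      g (br x y) (\<alpha> z) + g (br z y) (\<alpha> x) + g (br z x) (\<alpha> y) \<longleftrightarrow> g (M x y) (\<alpha> z) = K x y (\<alpha> z)"
    for M :: "'a \<Rightarrow> 'a \<Rightarrow> 'a" and x y z
    by (auto simp: K_def involutive)
  have "bilinear N"
    unfolding bilinear_def
    by (intro conjI allI linearI; rule metric_eqI)
      (simp_all add: N simps K_def algebra_simps add_divide_distrib)
  show ?thesis
  proof (rule ex1I[of _ N])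
    show "bilinear N \<and> (\<forall>x y z. 2 * g (N x y) (\<alpha> z) =
        g (br x y) (\<alpha> z) + g (br z y) (\<alpha> x) + g (br z x) (\<alpha> y))"
      using \<open>bilinear N\<close> by (simp add: N K_def involutive)
  next
    fix M
    assume "bilinear M \<and> (\<forall>x y z. 2 * g (M x y) (\<alpha> z) =
        g (br x y) (\<alpha> z) + g (br z y) (\<alpha> x) + g (br z x) (\<alpha> y))"
    then have "g (M x y) (\<alpha> z) = g (N x y) (\<alpha> z)" for x y z
      by (simp add: koszul N)
    then have "g (M x y) z = g (N x y) z" for x y z
      using involutive by metis
    then show "M = N"
      by (intro ext metric_eqI)
  qed
qed

end

theory Submission
  imports Defs
begin

text \<open>For a Killing vector \<open>v\<close> the map \<open>T z = \<alpha> (\<nabla>\<^bsub>z\<^esub> v)\<close> is skew for the metric, and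
  \<open>\<nabla>\<^bsub>v\<^esub> v = 0\<close>. In \<open>Ric v v\<close> the term with \<open>\<nabla>\<^bsub>v\<^esub> v\<close> therefore vanishes, the terms
  \<open>\<nabla>\<^bsub>\<alpha> v\<^esub> \<nabla>\<^bsub>z\<^esub> v\<close> and \<open>\<nabla>\<^bsub>\<nabla>\<^bsub>v\<^esub> z\<^esub> (\<alpha> v)\<close> cancel by cyclicity of the trace, and what remains is
  \<open>Ric v v = - tr (T \<circ> T)\<close>. If \<open>v\<close> is timelike, flipping the sign of the metric along \<open>v\<close> gives a
  positive definite form for which \<open>T\<close> is still skew, because \<open>T v = 0\<close> and the image of \<open>T\<close>
  is orthogonal to \<open>v\<close>. Hence \<open>Ric v v \<ge> 0\<close>, with equality only for \<open>T = 0\<close>.\<close>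

section \<open>Linearity and cyclicity of the trace\<close>

lemma linear_trace_add:
  fixes f f' :: "'a::real_vector \<Rightarrow> 'a" and B :: "'a set"
  assumes "finite B" "independent B" "span B = UNIV" "linear f" "linear f'"
  shows "linear_trace (\<lambda>z. f z + f' z) = linear_trace f + linear_trace f'"
  using assms
  by (simp add: linear_trace_eq[of _ B] linear_compose_add real_vector.representation_add
      sum.distrib)

lemma linear_trace_uminus:
  fixes f :: "'a::real_vector \<Rightarrow> 'a" and B :: "'a set"
  assumes "finite B" "independent B" "span B = UNIV" "linear f"
  shows "linear_trace (\<lambda>z. - f z) = - linear_trace f"
  using assms
  by (simp add: linear_trace_eq[of _ B] linear_compose_neg real_vector.representation_neg
      sum_negf)

text \<open>Expanding the inner value in the basis turns each side into a double sum of products of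
  matrix entries; the two differ only in the order of summation.\<close>

lemma linear_trace_comp_commute:
  fixes f f' :: "'a::real_vector \<Rightarrow> 'a" and B :: "'a set"
  assumes B: "finite B" "independent B" "span B = UNIV" and f: "linear f" and f': "linear f'"
  shows "linear_trace (\<lambda>z. f (f' z)) = linear_trace (\<lambda>z. f' (f z))"
proof -
  have exp: "representation B (k (l b)) b =
      (\<Sum>c\<in>B. representation B (l b) c * representation B (k c) b)"
    if "linear k" for k l :: "'a \<Rightarrow> 'a" and b
  proof -
    have "(\<Sum>c\<in>B. representation B (l b) c *\<^sub>R c) = l b"
      using real_vector.sum_representation_eq[of B "l b" B] B by auto
    moreover have "k (\<Sum>c\<in>B. representation B (l b) c *\<^sub>R c) =
        (\<Sum>c\<in>B. representation B (l b) c *\<^sub>R k c)"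
      using that by (simp add: linear_sum linear_scale)
    ultimately have "k (l b) = (\<Sum>c\<in>B. representation B (l b) c *\<^sub>R k c)"
      by simp
    then show ?thesis
      using B by (simp add: real_vector.representation_sum real_vector.representation_scale)
  qed
  have "linear_trace (\<lambda>z. f (f' z)) = (\<Sum>b\<in>B. representation B (f (f' b)) b)"
    using B linear_compose[OF f' f] by (intro linear_trace_eq) (auto simp: o_def)
  also have "\<dots> = (\<Sum>b\<in>B. \<Sum>c\<in>B. representation B (f' b) c * representation B (f c) b)"
    by (simp add: exp[OF f])
  also have "\<dots> = (\<Sum>c\<in>B. \<Sum>b\<in>B. representation B (f c) b * representation B (f' b) c)"
    by (subst sum.swap) (simp add: mult.commute)
  also have "\<dots> = (\<Sum>c\<in>B. representation B (f' (f c)) c)"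
    by (simp add: exp[OF f'])
  also have "\<dots> = linear_trace (\<lambda>z. f' (f z))"
    using B linear_compose[OF f f'] by (intro linear_trace_eq[symmetric]) (auto simp: o_def)
  finally show ?thesis .
qed

section \<open>Orthogonal bases and skew maps\<close>

lemma bilinear_orthogonal_sum:
  fixes h :: "'a::real_vector \<Rightarrow> 'a \<Rightarrow> real"
  assumes h: "bilinear h" and B: "finite B" "b \<in> B"
    and orth: "\<And>c. c \<in> B \<Longrightarrow> c \<noteq> b \<Longrightarrow> h c b = 0"
  shows "h (\<Sum>c\<in>B. r c *\<^sub>R c) b = r b * h b b"
proof -
  have lin: "linear (\<lambda>x. h x b)"
    using h by (simp add: bilinear_def)
  have "h (\<Sum>c\<in>B. r c *\<^sub>R c) b = (\<Sum>c\<in>B. r c * h c b)"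
    using linear_sum[OF lin, of "\<lambda>c. r c *\<^sub>R c" B] by (simp add: bilinear_lmul[OF h])
  also have "\<dots> = (\<Sum>c\<in>B. if c = b then r b * h b b else 0)"
    by (rule sum.cong) (auto simp: orth)
  finally show ?thesis
    using B by simp
qed

text \<open>Separate from the Hom-Lie structure because it is instantiated not with the metric,
  which is indefinite along timelike vectors, but with a sign-flipped modification of it.\<close>

locale positive_form =
  fixes h :: "'a::real_vector \<Rightarrow> 'a \<Rightarrow> real"
  assumes bilinear: "bilinear h"
    and sym: "h x y = h y x"
    and pos: "x \<noteq> 0 \<Longrightarrow> h x x > 0"
begin

text \<open>Gram-Schmidt without normalisation. A vector already in the span of its predecessors
  leaves residue 0 and is dropped, which keeps 0 out of \<open>C\<close>.\<close>

lemma orthogonal_spanning_set: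
  assumes "finite A"
  shows "\<exists>C. finite C \<and> 0 \<notin> C \<and> span C = span A \<and> (\<forall>b\<in>C. \<forall>c\<in>C. b \<noteq> c \<longrightarrow> h b c = 0)"
  using assms
proof (induction A rule: finite_induct)
  case empty
  show ?case by (intro exI[of _ "{}"]) simp
next
  case (insert a A)
  from insert.IH obtain C where "finite C \<and> 0 \<notin> C \<and> span C = span A \<and>
      (\<forall>b\<in>C. \<forall>c\<in>C. b \<noteq> c \<longrightarrow> h b c = 0)" ..
  then have C: "finite C" "0 \<notin> C" "span C = span A"
    and orth: "\<And>b c. b \<in> C \<Longrightarrow> c \<in> C \<Longrightarrow> b \<noteq> c \<Longrightarrow> h b c = 0"
    by simp_all
  \<comment> \<open>The orthogonal projection of \<open>a\<close> onto \<open>span C\<close>;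
    \<open>a'\<close> is the residue.\<close>
  define p where "p = (\<Sum>c\<in>C. (h a c / h c c) *\<^sub>R c)"
  define a' where "a' = a - p"
  have p: "p \<in> span C"
    unfolding p_def by (intro span_sum span_scale span_base)
  have a'C: "h a' c = 0" if "c \<in> C" for c
  proof -
    have "h p c = h a c / h c c * h c c"
      unfolding p_def using that C orth by (intro bilinear_orthogonal_sum bilinear) auto
    moreover have "h c c \<noteq> 0"
      using pos[of c] that C by fastforce
    ultimately show ?thesis
      by (simp add: a'_def bilinear_lsub[OF bilinear])
  qed
  have "span (insert a' C) = span (insert a C)"
    unfolding span_eq
  proof
    have "p \<in> span (insert a C)" "p \<in> span (insert a' C)"
      using p span_mono[of C "insert a C"] span_mono[of C "insert a' C"] by blast+
    then have "a - p \<in> span (insert a C)" "a' + p \<in> span (insert a' C)"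
      by (simp_all add: span_diff span_add span_base)
    then show "insert a' C \<subseteq> span (insert a C)" "insert a C \<subseteq> span (insert a' C)"
      by (simp_all add: a'_def subset_iff span_base)
  qed
  also have "\<dots> = span (insert a A)"
    using C(3) by (simp add: span_insert)
  finally have sp: "span (insert a' C) = span (insert a A)" .
  show ?case
  proof (cases "a' = 0")
    case True
    then show ?thesis
      using C(1,2) orth sp by (intro exI[of _ C]) (simp add: span_insert_0)
  next
    case False
    moreover have "h c a' = 0" if "c \<in> C" for c
      using a'C[OF that] sym[of c a'] by simp
    ultimately show ?thesis
      using C(1,2) orth sp a'C by (intro exI[of _ "insert a' C"]) simp
  qed
qed

lemma orthogonal_basis:
  assumes "finite A" "span A = (UNIV :: 'a set)"
  obtains C where "finite C" "independent C" "span C = UNIV" "0 \<notin> C"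
    "\<And>b c. b \<in> C \<Longrightarrow> c \<in> C \<Longrightarrow> b \<noteq> c \<Longrightarrow> h b c = 0"
proof -
  obtain C where C: "finite C" "0 \<notin> C" "span C = UNIV"
    and orth: "\<And>b c. b \<in> C \<Longrightarrow> c \<in> C \<Longrightarrow> b \<noteq> c \<Longrightarrow> h b c = 0"
    using orthogonal_spanning_set[OF assms(1)] assms(2) by auto
  have "independent C"
  proof (rule real_vector.independent_if_scalars_zero[OF C(1)])
    fix r c
    assume 0: "(\<Sum>x\<in>C. r x *\<^sub>R x) = 0" and c: "c \<in> C"
    have "r c * h c c = 0"
      using bilinear_orthogonal_sum[OF bilinear C(1) c, of r] orth c
      by (simp add: 0 bilinear_lzero[OF bilinear])
    then show "r c = 0"
      using pos[of c] c C(2) by fastforce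
  qed
  then show thesis
    using that C orth by blast
qed

text \<open>In an orthogonal basis the diagonal entry of \<open>T\<close> composed with itself at
  \<open>c\<close> is \<open>h (T (T c)) c / h c c\<close>, which skewness turns into
  \<open>- h (T c) (T c) / h c c\<close>. The trace is thus minus a sum of nonnegative terms and
  vanishes only if \<open>T\<close> kills every basis vector.\<close>

lemma linear_trace_skew_square:
  assumes fin: "finite A" "span A = (UNIV :: 'a set)" and T: "linear T"
    and skew: "\<And>x y. h (T x) y = - h x (T y)"
  shows "linear_trace (\<lambda>z. T (T z)) \<le> 0"
    and "linear_trace (\<lambda>z. T (T z)) = 0 \<Longrightarrow> T x = 0"
proof -
  obtain C where C: "finite C" "independent C" "span C = UNIV" "0 \<notin> C"
    and orth: "\<And>b c. b \<in> C \<Longrightarrow> c \<in> C \<Longrightarrow> b \<noteq> c \<Longrightarrow> h b c = 0"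
    using orthogonal_basis[OF fin] by blast
  have posC: "h c c > 0" if "c \<in> C" for c
    using pos[of c] that C(4) by auto
  have rep: "representation C x c = h x c / h c c" if "c \<in> C" for x c
  proof -
    have "(\<Sum>b\<in>C. representation C x b *\<^sub>R b) = x"
      using real_vector.sum_representation_eq[of C x C] C by auto
    then have "h x c = representation C x c * h c c"
      using bilinear_orthogonal_sum[OF bilinear C(1) that, of "representation C x"] orth that
      by simp
    then show ?thesis
      using posC[OF that] by simp
  qed
  have "linear_trace (\<lambda>z. T (T z)) = (\<Sum>c\<in>C. representation C (T (T c)) c)"
    using C linear_compose[OF T T] by (intro linear_trace_eq) (auto simp: o_def)
  then have tr: "linear_trace (\<lambda>z. T (T z)) = - (\<Sum>c\<in>C. h (T c) (T c) / h c c)"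
    by (simp add: rep skew sum_negf)
  have nonneg: "h (T c) (T c) / h c c \<ge> 0" if "c \<in> C" for c
    using posC[OF that] pos[of "T c"] bilinear_lzero[OF bilinear]
    by (cases "T c = 0") (auto intro: less_imp_le)
  show "linear_trace (\<lambda>z. T (T z)) \<le> 0"
    unfolding tr using nonneg by (simp add: sum_nonneg)
  assume "linear_trace (\<lambda>z. T (T z)) = 0"
  then have "T c = 0" if "c \<in> C" for c
    using sum_nonneg_eq_0_iff[OF C(1), of "\<lambda>c. h (T c) (T c) / h c c"] nonneg tr that
      posC[OF that] pos[of "T c"] by fastforce
  then show "T x = 0"
    using linear_eq_0_on_span[OF T, of C x] C(3) by auto
qed

end

section \<open>Properties of the Hom-Levi-Civita connection\<close>

context involutive_lorentzian_hom_lie_algebra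
begin

abbreviation nabla :: "'a \<Rightarrow> 'a \<Rightarrow> 'a" where
  "nabla \<equiv> hom_levi_civita br \<alpha> g"

lemmas metric_simps =
  bilinear_ladd[OF bilinear_metric] bilinear_radd[OF bilinear_metric]
  bilinear_lmul[OF bilinear_metric] bilinear_rmul[OF bilinear_metric]
  bilinear_lsub[OF bilinear_metric] bilinear_rsub[OF bilinear_metric]
  bilinear_lneg[OF bilinear_metric] bilinear_rneg[OF bilinear_metric]
  bilinear_lzero[OF bilinear_metric] bilinear_rzero[OF bilinear_metric]

lemma bilinear_nabla: "bilinear nabla"
  and koszul: "2 * g (nabla x y) (\<alpha> z) =
    g (br x y) (\<alpha> z) + g (br z y) (\<alpha> x) + g (br z x) (\<alpha> y)"
  using theI'[OF hom_levi_civita_ex1] unfolding hom_levi_civita_def by auto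

text \<open>An isometry that is its own inverse is self-adjoint.\<close>

lemma metric_twist_left: "g (\<alpha> x) y = g x (\<alpha> y)"
  using twist_isometry[of x "\<alpha> y"] by (simp add: involutive)

text \<open>Adapts nondegeneracy to the Koszul formula, which tests only against vectors
  \<open>\<alpha> z\<close>; these are all vectors, since \<open>\<alpha>\<close> is an
  involution.\<close>

lemma metric_twist_eqI:
  assumes "\<And>z. g x (\<alpha> z) = g y (\<alpha> z)"
  shows "x = y"
  using assms by (metis involutive metric_eqI)

lemma metric_bracket_skew: "g (br x y) z = - g (br y x) z"
  using bracket_skew[of x y] by (simp add: metric_simps)

text \<open>Exchanging \<open>x\<close> and \<open>y\<close> in the Koszul formula swaps its last
  two terms and negates the first, so the difference of the two instances keeps only the
  bracket.\<close>

lemma nabla_torsion_free: "br x y = nabla x y - nabla y x"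
proof (rule metric_twist_eqI)
  fix z
  show "g (br x y) (\<alpha> z) = g (nabla x y - nabla y x) (\<alpha> z)"
    using koszul[of x y z] koszul[of y x z] metric_bracket_skew[of y x "\<alpha> z"]
    by (simp add: metric_simps)
qed

text \<open>Adding the Koszul formulas for \<open>x y z\<close> and \<open>x z y\<close>, the six
  terms cancel in pairs by skewness of the bracket.\<close>

lemma nabla_metric: "g (nabla x y) (\<alpha> z) = - g (\<alpha> y) (nabla x z)"
  using koszul[of x y z] koszul[of x z y] metric_bracket_skew[of x y "\<alpha> z"]
    metric_bracket_skew[of x z "\<alpha> y"] metric_bracket_skew[of y z "\<alpha> x"]
    metric_sym[of "\<alpha> y" "nabla x z"]
  by linarith

lemma twist_nabla: "\<alpha> (nabla x y) = nabla (\<alpha> x) (\<alpha> y)"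
proof (rule metric_twist_eqI)
  fix z
  \<comment> \<open>Writing \<open>z\<close> as \<open>\<alpha> (\<alpha> z)\<close> exposes every
    bracket as the image under \<open>\<alpha>\<close> of one occurring in the Koszul formula for
    \<open>x\<close>, \<open>y\<close> and \<open>\<alpha> z\<close>.\<close>
  have "2 * g (nabla (\<alpha> x) (\<alpha> y)) (\<alpha> z) =
      g (\<alpha> (br x y)) (\<alpha> z) + g (\<alpha> (br (\<alpha> z) y)) x + g (\<alpha> (br (\<alpha> z) x)) y"
    by (simp add: koszul twist_bracket involutive)
  also have "\<dots> = 2 * g (nabla x y) (\<alpha> (\<alpha> z))"
    unfolding koszul by (simp add: metric_twist_left involutive)
  also have "\<dots> = 2 * g (\<alpha> (nabla x y)) (\<alpha> z)"
    by (simp add: metric_twist_left)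
  finally show "g (\<alpha> (nabla x y)) (\<alpha> z) = g (nabla (\<alpha> x) (\<alpha> y)) (\<alpha> z)"
    by simp
qed

text \<open>The Killing equation trades \<open>nabla v v\<close> for
  \<open>g (nabla x v) (\<alpha> v)\<close>, which equals its own negative by metric
  compatibility.\<close>

lemma killing_nabla_self:
  assumes "hom_killing br \<alpha> g v"
  shows "nabla v v = 0"
proof (rule metric_twist_eqI)
  fix x
  have "g (nabla x v) (\<alpha> v) = 0"
    using nabla_metric[of x v v] metric_sym[of "\<alpha> v" "nabla x v"] by simp
  moreover have "g (nabla v v) (\<alpha> x) = - g (nabla x v) (\<alpha> v)"
    using assms unfolding hom_killing_def by blast
  ultimately show "g (nabla v v) (\<alpha> x) = g 0 (\<alpha> x)"
    by (simp add: metric_simps)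
qed

section \<open>Ricci curvature along a Killing vector\<close>

lemma finite_basis:
  obtains B :: "'a set" where "finite B" "independent B" "span B = UNIV"
  using lorentzian unfolding has_signature_def by blast

lemma linear_nabla_left: "linear (\<lambda>x. nabla x y)"
  and linear_nabla_right: "linear (nabla x)"
  using bilinear_nabla by (auto simp: bilinear_def)

lemma ricci_killing:
  assumes v: "hom_killing br \<alpha> g v"
  shows "hom_ricci br \<alpha> g v v = - linear_trace (\<lambda>z. \<alpha> (nabla (\<alpha> (nabla z v)) v))"
proof -
  obtain B :: "'a set" where B: "finite B" "independent B" "span B = UNIV"
    by (rule finite_basis)
  define F where "F z = nabla (\<alpha> v) (nabla z v)" for z
  define G where "G z = nabla (nabla v z) (\<alpha> v)" for z
  define H where "H z = nabla (nabla z v) (\<alpha> v)" for z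
  have F: "linear F" and G: "linear G" and H: "linear H"
    using linear_compose[OF linear_nabla_left[of v] linear_nabla_right[of "\<alpha> v"]]
      linear_compose[OF linear_nabla_right[of v] linear_nabla_left[of "\<alpha> v"]]
      linear_compose[OF linear_nabla_left[of v] linear_nabla_left[of "\<alpha> v"]]
    by (simp_all add: F_def[abs_def] G_def[abs_def] H_def[abs_def] o_def)
  \<comment> \<open>Torsion-freeness splits the bracket term of the curvature into \<open>G\<close>
    and \<open>H\<close>; the first curvature term contains \<open>nabla v v\<close> and drops
    out.\<close>
  have "hom_curvature br \<alpha> g z v v = - F z + G z + - H z" for z
    unfolding hom_curvature_def Let_def nabla_torsion_free[of z v] F_def G_def H_def
    using killing_nabla_self[OF v]
    by (simp add: bilinear_lsub[OF bilinear_nabla] bilinear_rzero[OF bilinear_nabla])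
  then have "hom_ricci br \<alpha> g v v = - linear_trace F + linear_trace G + - linear_trace H"
    unfolding hom_ricci_def
    using linear_trace_add[OF B linear_compose_add[OF linear_compose_neg[OF F] G]
        linear_compose_neg[OF H]]
      linear_trace_add[OF B linear_compose_neg[OF F] G]
      linear_trace_uminus[OF B F] linear_trace_uminus[OF B H] by simp
  \<comment> \<open>Cyclicity is used twice: first to carry the outer \<open>\<alpha>\<close> to the
    inside, where it is absorbed by \<open>twist_nabla\<close>, then to exchange
    \<open>nabla v\<close> with the map sending \<open>z\<close> to
    \<open>nabla z (\<alpha> v)\<close>.\<close>
  moreover have "linear_trace F = linear_trace G"
  proof -
    have "linear_trace F = linear_trace (\<lambda>z. \<alpha> (nabla v (\<alpha> (nabla z v))))"
      by (simp add: F_def[abs_def] twist_nabla involutive)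
    also have "\<dots> = linear_trace (\<lambda>z. nabla v (\<alpha> (nabla (\<alpha> z) v)))"
      using linear_compose[OF linear_compose[OF linear_nabla_left[of v] linear_twist]
          linear_nabla_right[of v]]
      by (intro linear_trace_comp_commute[OF B linear_twist, of "\<lambda>z. nabla v (\<alpha> (nabla z v))"])
        (simp add: o_def)
    also have "\<dots> = linear_trace (\<lambda>z. nabla v (nabla z (\<alpha> v)))"
      by (simp add: twist_nabla involutive)
    also have "\<dots> = linear_trace G"
      unfolding G_def[abs_def]
      by (rule linear_trace_comp_commute[OF B linear_nabla_right linear_nabla_left])
    finally show ?thesis .
  qed
  moreover have "H = (\<lambda>z. \<alpha> (nabla (\<alpha> (nabla z v)) v))"
    by (simp add: H_def fun_eq_iff twist_nabla involutive)
  ultimately show ?thesis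
    by simp
qed

section \<open>Positivity off the negative direction of a Lorentzian metric\<close>

lemma metric_positive_on_complement:
  obtains b where "\<And>u. g u b = 0 \<Longrightarrow> u \<noteq> 0 \<Longrightarrow> g u u > 0"
proof -
  obtain B where B: "finite B" "independent B" "span B = UNIV"
    and orth: "\<And>b c. b \<in> B \<Longrightarrow> c \<in> B \<Longrightarrow> b \<noteq> c \<Longrightarrow> g b c = 0"
    and neg: "card {b\<in>B. g b b < 0} = 1"
    using lorentzian unfolding has_signature_def by blast
  \<comment> \<open>The single negative vector of the orthogonal basis is the witness. Orthogonality
    to it kills the coordinate \<open>r b\<close>, so only positive squares remain in
    \<open>g u u\<close>.\<close>
  obtain b where b: "{b\<in>B. g b b < 0} = {b}"
    using neg by (auto simp: card_1_singleton_iff)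
  have "g u u > 0" if ub: "g u b = 0" and u0: "u \<noteq> 0" for u
  proof -
    define r where "r = representation B u"
    have u: "(\<Sum>c\<in>B. r c *\<^sub>R c) = u"
      unfolding r_def using real_vector.sum_representation_eq[of B u B] B by auto
    have coord: "g u c = r c * g c c" if "c \<in> B" for c
      using bilinear_orthogonal_sum[OF bilinear_metric B(1) that, of r] orth that
      by (simp add: u)
    have rb: "r b = 0"
    proof -
      have "b \<in> B" "g b b < 0"
        using b by blast+
      then show ?thesis
        using coord[of b] ub by simp
    qed
    \<comment> \<open>A null vector of an orthogonal basis would be orthogonal to the whole space,
      hence zero.\<close>
    have nn: "g c c \<noteq> 0" if "c \<in> B" for c
    proof
      assume c: "g c c = 0"
      have "g x c = 0" for x
      proof -
        have "(\<Sum>d\<in>B. representation B x d *\<^sub>R d) = x"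
          using real_vector.sum_representation_eq[of B x B] B by auto
        then show ?thesis
          using bilinear_orthogonal_sum[OF bilinear_metric B(1) that, of "representation B x"]
            orth that c by simp
      qed
      then have "c = 0"
        by (intro metric_nondegenerate) (simp add: metric_sym)
      then show False
        using B(2) that real_vector.dependent_zero by blast
    qed
    have "g u u = (\<Sum>c\<in>B. r c * g u c)"
      using linear_sum[of "g u" "\<lambda>c. r c *\<^sub>R c" B] bilinear_metric u
      by (simp add: bilinear_def metric_simps)
    then have guu: "g u u = (\<Sum>c\<in>B. (r c)\<^sup>2 * g c c)"
      by (simp add: coord power2_eq_square mult.assoc)
    obtain d where d: "d \<in> B" "r d \<noteq> 0"
      using u u0 by (metis (no_types, lifting) scale_eq_0_iff sum.neutral)
    have pos: "g c c > 0" if "c \<in> B" "r c \<noteq> 0" for c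
      using nn[OF that(1)] b rb that by fastforce
    have "(\<Sum>c\<in>B. (r c)\<^sup>2 * g c c) > 0"
    proof (rule sum_pos2[OF B(1) d(1)])
      show "0 < (r d)\<^sup>2 * g d d"
        using pos[OF d] d by simp
      show "0 \<le> (r c)\<^sup>2 * g c c" if "c \<in> B" for c
        using pos[OF that] by (cases "r c = 0") auto
    qed
    then show ?thesis
      by (simp add: guu)
  qed
  then show thesis
    using that by blast
qed

text \<open>Otherwise the metric would be negative semidefinite on the plane spanned by
  \<open>v\<close> and \<open>w\<close>, but this plane contains a nonzero vector orthogonal to
  \<open>b\<close>, on which the metric is positive.\<close>

lemma timelike_complement_positive:
  assumes v: "timelike g v" and w: "g w v = 0" "w \<noteq> 0"
  shows "g w w > 0"
proof (rule ccontr)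
  assume "\<not> g w w > 0"
  obtain b where b: "\<And>u. g u b = 0 \<Longrightarrow> u \<noteq> 0 \<Longrightarrow> g u u > 0"
    by (rule metric_positive_on_complement) blast
  have v0: "g v v < 0"
    using v by (simp add: timelike_def)
  then have vb: "g v b \<noteq> 0"
    using b[of v] bilinear_lzero[OF bilinear_metric] by force
  \<comment> \<open>The coefficients are chosen so that the pairing with \<open>b\<close> cancels.
    If \<open>u\<close> is 0, pairing it with \<open>v\<close> gives \<open>g w b = 0\<close>, and
    then \<open>w\<close> itself must vanish.\<close>
  define u where "u = g w b *\<^sub>R v - g v b *\<^sub>R w"
  have "g u b = 0"
    by (simp add: u_def metric_simps)
  have uv: "g u v = g w b * g v v"
    using w by (simp add: u_def metric_simps)
  have "g u u = (g w b)\<^sup>2 * g v v + (g v b)\<^sup>2 * g w w"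
    using w metric_sym[of v w]
    by (simp add: u_def metric_simps power2_eq_square algebra_simps)
  also have "\<dots> \<le> 0"
    using v0 \<open>\<not> g w w > 0\<close> by (intro add_nonpos_nonpos mult_nonneg_nonpos) auto
  finally have u: "u = 0"
    using b[OF \<open>g u b = 0\<close>] by force
  then have "g w b = 0"
    using uv v0 by (simp add: metric_simps)
  then show False
    using u vb w by (simp add: u_def)
qed

text \<open>The correction term replaces \<open>g v v\<close> by \<open>- g v v\<close> and does
  nothing on the orthogonal complement of \<open>v\<close>, where the metric is already
  positive.\<close>

lemma timelike_flip_positive_form:
  assumes v: "timelike g v"
  shows "positive_form (\<lambda>x y. g x y - 2 / g v v * (g x v * g y v))"
proof
  have v0: "g v v < 0"
    using v by (simp add: timelike_def)
  show "bilinear (\<lambda>x y. g x y - 2 / g v v * (g x v * g y v))"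
    unfolding bilinear_def by (intro conjI allI linearI) (simp_all add: metric_simps algebra_simps)
  show "g x y - 2 / g v v * (g x v * g y v) = g y x - 2 / g v v * (g y v * g x v)" for x y
    by (simp add: metric_sym[of x y])
  fix x :: 'a assume x: "x \<noteq> 0"
  \<comment> \<open>Splits \<open>x\<close> into its component \<open>t\<close> along
    \<open>v\<close> and a part \<open>w\<close> orthogonal to \<open>v\<close>; the form then
    becomes \<open>g w w - t * t * g v v\<close>, with both contributions nonnegative.\<close>
  define t where "t = g x v / g v v"
  define w where "w = x - t *\<^sub>R v"
  have xv: "g x v = t * g v v"
    using v0 by (simp add: t_def)
  have wv: "g w v = 0"
    by (simp add: w_def metric_simps xv)
  have xtw: "x = t *\<^sub>R v + w"
    by (simp add: w_def)
  have "g x x = t * t * g v v + g w w"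
    unfolding xtw using wv metric_sym[of v w] by (simp add: metric_simps)
  then have eq: "g x x - 2 / g v v * (g x v * g x v) = g w w - t * t * g v v"
    using v0 by (simp add: xv)
  show "g x x - 2 / g v v * (g x v * g x v) > 0"
  proof (cases "w = 0")
    case True
    then have "t \<noteq> 0"
      using x xtw by auto
    then have "t * t * g v v < 0"
      using v0 by (intro mult_pos_neg) (auto simp: zero_less_mult_iff)
    then show ?thesis
      unfolding eq using True by (simp add: metric_simps)
  next
    case False
    have "t * t * g v v \<le> 0"
      using v0 by (intro mult_nonneg_nonpos) auto
    then show ?thesis
      using timelike_complement_positive[OF v wv False] unfolding eq by simp
  qed
qed

section \<open>The sign of the Ricci curvature on timelike Killing vectors\<close>

lemma ricci_timelike_killing:
  assumes v: "timelike g v" and killing: "hom_killing br \<alpha> g v"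
  shows "hom_ricci br \<alpha> g v v \<ge> 0"
    and "hom_ricci br \<alpha> g v v = 0 \<Longrightarrow> hom_parallel br \<alpha> g v"
proof -
  define T where "T z = \<alpha> (nabla z v)" for z
  define h where "h x y = g x y - 2 / g v v * (g x v * g y v)" for x y
  interpret h: positive_form h
    unfolding h_def by (rule timelike_flip_positive_form[OF v])
  obtain B :: "'a set" where B: "finite B" "independent B" "span B = UNIV"
    by (rule finite_basis)
  have T: "linear T"
    using linear_compose[OF linear_nabla_left linear_twist] by (simp add: T_def[abs_def] o_def)
  have skew: "g (T x) y = - g x (T y)" for x y
  proof -
    have "g (nabla x v) (\<alpha> y) = - g (nabla y v) (\<alpha> x)"
      using killing unfolding hom_killing_def by blast
    then show ?thesis
      using metric_sym[of x "\<alpha> (nabla y v)"] by (simp add: T_def metric_twist_left)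
  qed
  have "T v = 0"
    using killing_nabla_self[OF killing] linear_0[OF linear_twist] by (simp add: T_def)
  \<comment> \<open>Consequently the correction term of \<open>h\<close> vanishes whenever one
    argument lies in the image of \<open>T\<close>, and skewness passes from \<open>g\<close> to
    \<open>h\<close>.\<close>
  then have "g (T x) v = 0" for x
    by (simp add: skew metric_simps)
  then have "h (T x) y = - h x (T y)" for x y
    by (simp add: h_def skew[of x y])
  note trace = h.linear_trace_skew_square[OF B(1,3) T this]
  have ric: "hom_ricci br \<alpha> g v v = - linear_trace (\<lambda>z. T (T z))"
    using ricci_killing[OF killing] by (simp add: T_def)
  show "hom_ricci br \<alpha> g v v \<ge> 0"
    using trace(1) by (simp add: ric)
  assume "hom_ricci br \<alpha> g v v = 0"
  then have "\<alpha> (nabla x v) = 0" for x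
    using trace(2) by (simp add: ric T_def)
  then have "nabla x v = 0" for x
    by (metis involutive linear_0 linear_twist)
  then show "hom_parallel br \<alpha> g v"
    by (simp add: hom_parallel_def)
qed

end

theorem theorem13:
  fixes br :: "'a::real_vector \<Rightarrow> 'a \<Rightarrow> 'a"
    and \<alpha> :: "'a \<Rightarrow> 'a"
    and g :: "'a \<Rightarrow> 'a \<Rightarrow> real"
  assumes "involutive_lorentzian_hom_lie_algebra br \<alpha> g"
  shows "((\<forall>x. timelike g x \<longrightarrow> hom_ricci br \<alpha> g x x < 0) \<longrightarrow>
            \<not> (\<exists>v. v \<noteq> 0 \<and> timelike g v \<and> hom_killing br \<alpha> g v)) \<and>
         ((\<forall>x. timelike g x \<longrightarrow> hom_ricci br \<alpha> g x x \<le> 0) \<longrightarrow>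
            (\<forall>v. timelike g v \<and> hom_killing br \<alpha> g v \<longrightarrow> hom_parallel br \<alpha> g v))"
proof -
  interpret involutive_lorentzian_hom_lie_algebra br \<alpha> g
    by (fact assms)
  show ?thesis
    \<comment> \<open>In (i) the strict inequality contradicts nonnegativity; in (ii) the two
      inequalities force \<open>hom_ricci br \<alpha> g v v = 0\<close>, the equality case.\<close>
    using ricci_timelike_killing by (meson antisym not_le)
qed

end
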